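(* Let $a,b,\alpha,\beta \in \mathbb{R}$ with $b\beta \neq 0$. Then $$\frac{a}{b} \odot \frac{\alpha}{\beta} = \frac{a}{b} + \frac{\alpha}{\beta}$$ if and only if $$\alpha b^2 + a\beta^2 = 0.$$
   Context: The dual multiplication (also called pupil fraction addition) $\odot$ is defined in terms of the given numerators and denominators $a,b,\alpha,\beta$ by $$\frac{a}{b}\odot\frac{\alpha}{\beta} := \frac{a+\alpha}{b+\beta}.$$ The operation $+$ is the usual addition of fractions, $\frac{a}{b}+\frac{\alpha}{\beta} := \frac{a\beta+\alpha b}{b\beta}$.
   Formalization: The condition b + β ≠ 0 is added: when β = −b the left-hand side (a+α)/(b+β) has denominator zero and is undefined, e.g. a = 1, α = −1, b = 1, β = −1 gives 0/0. *)

theory Defs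
  imports Complex_Main
begin

text \<open>
  The dual multiplication depends on the chosen numerator and denominator of each operand and not
  only on their quotients, so it acts on formal fractions. The pair \<open>(a, b)\<close> stands for the written
  fraction \<open>a/b\<close>; different pairs with the same value are different formal fractions.
\<close>

type_synonym fraction = "real \<times> real"

definition fraction_value :: "fraction \<Rightarrow> real"
  where "fraction_value p = fst p / snd p"

definition dual_mult :: "fraction \<Rightarrow> fraction \<Rightarrow> fraction"  (infixl \<open>\<odot>\<close> 70)
  where "p \<odot> q = (fst p + fst q, snd p + snd q)"

end

theory Submission
  imports Defs
begin

text \<open>
  After clearing denominators the two sides of the equation become \<open>(a + \<alpha>) b \<beta>\<close> and
  \<open>(a \<beta> + \<alpha> b) (b + \<beta>)\<close>. The second product contains both mixed terms \<open>a b \<beta>\<close> and \<open>\<alpha> b \<beta>\<close>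
  of the first, so the equation says precisely that its two remaining terms cancel.
\<close>

theorem proposition1:
  fixes a b \<alpha> \<beta> :: real
  assumes "b * \<beta> \<noteq> 0"
    and "b + \<beta> \<noteq> 0"
  shows "fraction_value ((a, b) \<odot> (\<alpha>, \<beta>)) = fraction_value (a, b) + fraction_value (\<alpha>, \<beta>)
    \<longleftrightarrow> \<alpha> * b\<^sup>2 + a * \<beta>\<^sup>2 = 0"
proof -
  have "fraction_value (a, b) + fraction_value (\<alpha>, \<beta>) = (a * \<beta> + \<alpha> * b) / (b * \<beta>)"
    using assms(1) by (simp add: fraction_value_def add_frac_eq)
  moreover have "fraction_value ((a, b) \<odot> (\<alpha>, \<beta>)) = (a + \<alpha>) / (b + \<beta>)"
    by (simp add: fraction_value_def dual_mult_def)
  ultimately have "fraction_value ((a, b) \<odot> (\<alpha>, \<beta>)) = fraction_value (a, b) + fraction_value (\<alpha>, \<beta>)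
      \<longleftrightarrow> (a + \<alpha>) * (b * \<beta>) = (a * \<beta> + \<alpha> * b) * (b + \<beta>)"
    using frac_eq_eq[OF assms(2,1)] by simp
  also have "(a * \<beta> + \<alpha> * b) * (b + \<beta>) = (a + \<alpha>) * (b * \<beta>) + (\<alpha> * b\<^sup>2 + a * \<beta>\<^sup>2)"
    by (simp add: algebra_simps power2_eq_square)
  finally show ?thesis
    by linarith
qed

end
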